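(* Let $M$ be a monoid with identity $e$ and $\alpha$ a strong partial action of $M$ on a semigroup $X$. Let $\overline{\beta}=\{\overline{\beta}_n\}_{n\in M}$ be the global action of $M$ on the semigroup $X_M^+/R^\#$ given on generators by $\overline{\beta}_n([m,x])=[nm,x]$, and let $\overline{\iota}:X\to X_M^+/R^\#$, $\overline{\iota}(x)=[e,x]$. Then $(\overline{\beta},\overline{\iota})$ is a universal globalization of $\alpha$ (in the category of semigroups) if and only if for all $m\in M$ and $x,y\in X$ with $[m,x]\overset{*}{\leftrightarrow}[e,y]$ (as one-letter words of $X_M^+$) we have $[m,x]=[e,y]$ in $X_M$.
   Context: Let $M$ be a monoid with identity $e$. A strong partial action of $M$ on a set $X$ is a family $\alpha=\{\alpha_m:\operatorname{dom}\alpha_m\to X\}_{m\in M}$ of maps with $\operatorname{dom}\alpha_m\subseteq X$ such that: (1) $\operatorname{dom}\alpha_e=X$ and $\alpha_e=\mathrm{id}_X$; (2) $\alpha_m^{-1}(\operatorname{dom}\alpha_n)=\operatorname{dom}\alpha_{nm}\cap\operatorname{dom}\alpha_m$ for all $m,n\in M$; (3) $\alpha_n\circ\alpha_m=\alpha_{nm}$ on $\alpha_m^{-1}(\operatorname{dom}\alpha_n)$ for all $m,n\in M$. It is a global action if $\operatorname{dom}\alpha_m=X$ for all $m$. A strong partial action (global action) of $M$ on a semigroup $X$ is one on the underlying set such that each $\operatorname{dom}\alpha_m$ is a (possibly empty) subsemigroup of $X$ and each $\alpha_m$ is a semigroup homomorphism. If $\alpha$ is a strong partial action of $M$ on a semigroup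 $X$ and $\beta$ is a global action of $M$ on a semigroup $Y$, a morphism $\iota:\alpha\to\beta$ is a semigroup homomorphism $\iota:X\to Y$ with $\beta_m(\iota(x))=\iota(\alpha_m(x))$ for all $m\in M$, $x\in\operatorname{dom}\alpha_m$ (morphisms between global actions are defined in the same way). A globalization of $\alpha$ is a pair $(\beta,\iota)$, with $\beta$ a global action of $M$ on a semigroup and $\iota:\alpha\to\beta$ a morphism, such that for all $x,y\in X$ and $m\in M$ with $\beta_m(\iota(x))=\iota(y)$ one has $x\in\operatorname{dom}\alpha_m$ and $\alpha_m(x)=y$. It is universal if for any globalization $(\gamma,\kappa)$ of $\alpha$ there is a unique morphism $\kappa':\beta\to\gamma$ with $\kappa'\circ\iota=\kappa$. $X_M=(M\times X)/{\approx}$, where $\approx$ is the equivalence relation generated by: $(m,x)\rightharpoonup(n,y)$ iff there is $k\in M$ with $m=nk$, $x\in\operatorname{dom}\alpha_k$ and $y=\alpha_k(x)$. The class of $(m,x)$ is $[m,x]$. $X_M^+$ is the free semigroup on $X_M$ (nonempty words), $X_M^*$ the free monoid. $R^\#$ is the congruence on $X_M^+$ generated by all pairs $([m,x][m,y],[m,xy])$ with $m\in M$, $x,y\in X$; the $R^\#$-class of a word is denoted by the word itself. The maps $\overline\beta_n$ are well-defined semigroup endomorphisms of $X_M^+/R^\#$ forming a global action, and $\overline\iota$ is a morphism $\alpha\to\overline\beta$. The relation $\to$ on $X_M^+$ is: $u[m,x][m,y]v\to u[m,xy]v$ for all $u,v\in X_M^*$, $m\in M$, $x,y\in X$; $\overset{*}{\leftrightarrow}$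 is the smallest equivalence relation containing $\to$. *)

theory Defs
  imports "HOL-Algebra.Group"
begin

section \<open>Semigroups\<close>

text \<open>
  Carrier-based, in the style of HOL-Algebra, which has monoids but no semigroups.
  The empty semigroup is allowed.
\<close>

record 'a semigroup_rec = "'a partial_object" +
  smult :: "'a \<Rightarrow> 'a \<Rightarrow> 'a"  (infixl \<open>\<odot>\<index>\<close> 70)

locale semigrp =
  fixes S (structure)
  assumes smult_closed: "x \<in> carrier S \<Longrightarrow> y \<in> carrier S \<Longrightarrow> x \<odot> y \<in> carrier S"
    and smult_assoc: "x \<in> carrier S \<Longrightarrow> y \<in> carrier S \<Longrightarrow> z \<in> carrier S
          \<Longrightarrow> (x \<odot> y) \<odot> z = x \<odot> (y \<odot> z)"

definition subsemigroup :: "'a set \<Rightarrow> 'a semigroup_rec \<Rightarrow> bool" where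
  "subsemigroup D S \<longleftrightarrow> D \<subseteq> carrier S \<and> (\<forall>x\<in>D. \<forall>y\<in>D. x \<odot>\<^bsub>S\<^esub> y \<in> D)"

definition semigroup_hom :: "'a semigroup_rec \<Rightarrow> 'b semigroup_rec \<Rightarrow> ('a \<Rightarrow> 'b) set" where
  "semigroup_hom S T = {h. h \<in> carrier S \<rightarrow> carrier T \<and>
     (\<forall>x\<in>carrier S. \<forall>y\<in>carrier S. h (x \<odot>\<^bsub>S\<^esub> y) = h x \<odot>\<^bsub>T\<^esub> h y)}"

definition equiv_closure :: "'a set \<Rightarrow> ('a \<times> 'a) set \<Rightarrow> ('a \<times> 'a) set" where
  "equiv_closure A r = \<Inter>{s. equiv A s \<and> r \<subseteq> s}"

definition congruence_on :: "'a semigroup_rec \<Rightarrow> ('a \<times> 'a) set \<Rightarrow> bool" where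
  "congruence_on S r \<longleftrightarrow> equiv (carrier S) r \<and>
     (\<forall>a b c d. (a, b) \<in> r \<longrightarrow> (c, d) \<in> r \<longrightarrow> (a \<odot>\<^bsub>S\<^esub> c, b \<odot>\<^bsub>S\<^esub> d) \<in> r)"

definition congruence_closure :: "'a semigroup_rec \<Rightarrow> ('a \<times> 'a) set \<Rightarrow> ('a \<times> 'a) set" where
  "congruence_closure S r = \<Inter>{s. congruence_on S s \<and> r \<subseteq> s}"

text \<open>
  For a congruence \<open>r\<close> and classes \<open>U = r `` {u}\<close>, \<open>V = r `` {v}\<close> the union below is
  the single class \<open>r `` {u \<odot>\<^bsub>S\<^esub> v}\<close>.
\<close>

definition quotient_semigroup :: "'a semigroup_rec \<Rightarrow> ('a \<times> 'a) set \<Rightarrow> 'a set semigroup_rec" where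
  "quotient_semigroup S r =
     \<lparr>carrier = carrier S // r, smult = (\<lambda>U V. \<Union>u\<in>U. \<Union>v\<in>V. r `` {u \<odot>\<^bsub>S\<^esub> v})\<rparr>"

definition free_semigroup :: "'a set \<Rightarrow> 'a list semigroup_rec" where
  "free_semigroup A = \<lparr>carrier = lists A - {[]}, smult = (@)\<rparr>"


section \<open>Strong partial actions and globalizations\<close>

text \<open>
  The partial map \<open>\<alpha>\<^sub>m\<close> is a map \<open>\<alpha> m :: 'x \<rightharpoonup> 'x\<close>, with domain \<open>dom (\<alpha> m)\<close>, and
  \<open>\<alpha> m -` (Some ` B)\<close> is the preimage of \<open>B\<close> under it. Only the maps indexed by
  \<open>m \<in> carrier M\<close> matter.
\<close>

definition strong_partial_action_on_set ::
    "('m, 'b) monoid_scheme \<Rightarrow> 'x set \<Rightarrow> ('m \<Rightarrow> 'x \<rightharpoonup> 'x) \<Rightarrow> bool" where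
  "strong_partial_action_on_set M A \<alpha> \<longleftrightarrow>
     (\<forall>m\<in>carrier M. dom (\<alpha> m) \<subseteq> A \<and> ran (\<alpha> m) \<subseteq> A) \<and>
     dom (\<alpha> \<one>\<^bsub>M\<^esub>) = A \<and> (\<forall>x\<in>A. \<alpha> \<one>\<^bsub>M\<^esub> x = Some x) \<and>
     (\<forall>m\<in>carrier M. \<forall>n\<in>carrier M.
        \<alpha> m -` (Some ` dom (\<alpha> n)) = dom (\<alpha> (n \<otimes>\<^bsub>M\<^esub> m)) \<inter> dom (\<alpha> m)) \<and>
     (\<forall>m\<in>carrier M. \<forall>n\<in>carrier M. \<forall>x \<in> \<alpha> m -` (Some ` dom (\<alpha> n)).
        (\<alpha> n \<circ>\<^sub>m \<alpha> m) x = \<alpha> (n \<otimes>\<^bsub>M\<^esub> m) x)"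

definition strong_partial_action ::
    "('m, 'b) monoid_scheme \<Rightarrow> 'x semigroup_rec \<Rightarrow> ('m \<Rightarrow> 'x \<rightharpoonup> 'x) \<Rightarrow> bool" where
  "strong_partial_action M X \<alpha> \<longleftrightarrow>
     strong_partial_action_on_set M (carrier X) \<alpha> \<and>
     (\<forall>m\<in>carrier M. subsemigroup (dom (\<alpha> m)) X \<and>
        (\<lambda>x. the (\<alpha> m x)) \<in> semigroup_hom (X\<lparr>carrier := dom (\<alpha> m)\<rparr>) X)"

definition global_action ::
    "('m, 'b) monoid_scheme \<Rightarrow> 'x semigroup_rec \<Rightarrow> ('m \<Rightarrow> 'x \<rightharpoonup> 'x) \<Rightarrow> bool" where
  "global_action M X \<beta> \<longleftrightarrow>
     strong_partial_action M X \<beta> \<and> (\<forall>m\<in>carrier M. dom (\<beta> m) = carrier X)"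

definition action_morphism ::
    "('m, 'b) monoid_scheme \<Rightarrow> 'x semigroup_rec \<Rightarrow> ('m \<Rightarrow> 'x \<rightharpoonup> 'x) \<Rightarrow>
     'y semigroup_rec \<Rightarrow> ('m \<Rightarrow> 'y \<rightharpoonup> 'y) \<Rightarrow> ('x \<Rightarrow> 'y) \<Rightarrow> bool" where
  "action_morphism M X \<alpha> Y \<beta> h \<longleftrightarrow>
     h \<in> semigroup_hom X Y \<and>
     (\<forall>m\<in>carrier M. \<forall>x\<in>dom (\<alpha> m). \<beta> m (h x) = Some (h (the (\<alpha> m x))))"

definition globalization ::
    "('m, 'b) monoid_scheme \<Rightarrow> 'x semigroup_rec \<Rightarrow> ('m \<Rightarrow> 'x \<rightharpoonup> 'x) \<Rightarrow>
     'y semigroup_rec \<Rightarrow> ('m \<Rightarrow> 'y \<rightharpoonup> 'y) \<Rightarrow> ('x \<Rightarrow> 'y) \<Rightarrow> bool" where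
  "globalization M X \<alpha> Y \<beta> \<iota> \<longleftrightarrow>
     semigrp Y \<and> global_action M Y \<beta> \<and> action_morphism M X \<alpha> Y \<beta> \<iota> \<and>
     (\<forall>x\<in>carrier X. \<forall>y\<in>carrier X. \<forall>m\<in>carrier M.
        \<beta> m (\<iota> x) = Some (\<iota> y) \<longrightarrow> x \<in> dom (\<alpha> m) \<and> \<alpha> m x = Some y)"

text \<open>
  HOL cannot quantify over types inside a formula, so the semigroups against which
  universality is tested have their carriers in the type \<open>'z\<close> given by the first argument;
  a theorem in which \<open>'z\<close> is a free type variable covers all of them. The mediating
  morphism is required to be \<open>extensional\<close> because a map of HOL is total, so that
  uniqueness can hold on the carrier only.
\<close>

definition universal_globalization ::
    "'z itself \<Rightarrow> ('m, 'b) monoid_scheme \<Rightarrow> 'x semigroup_rec \<Rightarrow> ('m \<Rightarrow> 'x \<rightharpoonup> 'x) \<Rightarrow>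
     'y semigroup_rec \<Rightarrow> ('m \<Rightarrow> 'y \<rightharpoonup> 'y) \<Rightarrow> ('x \<Rightarrow> 'y) \<Rightarrow> bool" where
  "universal_globalization _ M X \<alpha> Y \<beta> \<iota> \<longleftrightarrow>
     globalization M X \<alpha> Y \<beta> \<iota> \<and>
     (\<forall>(Z :: 'z semigroup_rec) \<gamma> \<kappa>. globalization M X \<alpha> Z \<gamma> \<kappa> \<longrightarrow>
        (\<exists>!\<kappa>'. \<kappa>' \<in> extensional (carrier Y) \<and> action_morphism M Y \<beta> Z \<gamma> \<kappa>' \<and>
               (\<forall>x\<in>carrier X. \<kappa>' (\<iota> x) = \<kappa> x)))"


section \<open>The semigroup \<open>X\<^sub>M\<^sup>+ / R\<^sup>#\<close> and its action\<close>

definition XM_step ::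
    "('m, 'b) monoid_scheme \<Rightarrow> 'x semigroup_rec \<Rightarrow> ('m \<Rightarrow> 'x \<rightharpoonup> 'x) \<Rightarrow>
     (('m \<times> 'x) \<times> ('m \<times> 'x)) set" where
  "XM_step M X \<alpha> = {((m, x), (n, y)) | m x n y.
     m \<in> carrier M \<and> x \<in> carrier X \<and> n \<in> carrier M \<and> y \<in> carrier X \<and>
     (\<exists>k\<in>carrier M. m = n \<otimes>\<^bsub>M\<^esub> k \<and> x \<in> dom (\<alpha> k) \<and> \<alpha> k x = Some y)}"

definition XM_rel ::
    "('m, 'b) monoid_scheme \<Rightarrow> 'x semigroup_rec \<Rightarrow> ('m \<Rightarrow> 'x \<rightharpoonup> 'x) \<Rightarrow>
     (('m \<times> 'x) \<times> ('m \<times> 'x)) set" where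
  "XM_rel M X \<alpha> = equiv_closure (carrier M \<times> carrier X) (XM_step M X \<alpha>)"

definition XM ::
    "('m, 'b) monoid_scheme \<Rightarrow> 'x semigroup_rec \<Rightarrow> ('m \<Rightarrow> 'x \<rightharpoonup> 'x) \<Rightarrow> ('m \<times> 'x) set set" where
  "XM M X \<alpha> = (carrier M \<times> carrier X) // XM_rel M X \<alpha>"

text \<open>The class \<open>[m, x]\<close>.\<close>

definition XM_class ::
    "('m, 'b) monoid_scheme \<Rightarrow> 'x semigroup_rec \<Rightarrow> ('m \<Rightarrow> 'x \<rightharpoonup> 'x) \<Rightarrow>
     'm \<Rightarrow> 'x \<Rightarrow> ('m \<times> 'x) set" where
  "XM_class M X \<alpha> m x = XM_rel M X \<alpha> `` {(m, x)}"

abbreviation XM_words ::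
    "('m, 'b) monoid_scheme \<Rightarrow> 'x semigroup_rec \<Rightarrow> ('m \<Rightarrow> 'x \<rightharpoonup> 'x) \<Rightarrow>
     ('m \<times> 'x) set list semigroup_rec" where
  "XM_words M X \<alpha> \<equiv> free_semigroup (XM M X \<alpha>)"

definition R_sharp ::
    "('m, 'b) monoid_scheme \<Rightarrow> 'x semigroup_rec \<Rightarrow> ('m \<Rightarrow> 'x \<rightharpoonup> 'x) \<Rightarrow>
     (('m \<times> 'x) set list \<times> ('m \<times> 'x) set list) set" where
  "R_sharp M X \<alpha> = congruence_closure (XM_words M X \<alpha>)
     {([XM_class M X \<alpha> m x, XM_class M X \<alpha> m y], [XM_class M X \<alpha> m (x \<odot>\<^bsub>X\<^esub> y)]) | m x y.
        m \<in> carrier M \<and> x \<in> carrier X \<and> y \<in> carrier X}"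

definition word_step ::
    "('m, 'b) monoid_scheme \<Rightarrow> 'x semigroup_rec \<Rightarrow> ('m \<Rightarrow> 'x \<rightharpoonup> 'x) \<Rightarrow>
     (('m \<times> 'x) set list \<times> ('m \<times> 'x) set list) set" where
  "word_step M X \<alpha> =
     {(u @ [XM_class M X \<alpha> m x, XM_class M X \<alpha> m y] @ v,
       u @ [XM_class M X \<alpha> m (x \<odot>\<^bsub>X\<^esub> y)] @ v) | u v m x y.
        u \<in> lists (XM M X \<alpha>) \<and> v \<in> lists (XM M X \<alpha>) \<and>
        m \<in> carrier M \<and> x \<in> carrier X \<and> y \<in> carrier X}"

text \<open>The relation \<open>\<leftrightarrow>\<^sup>*\<close>.\<close>

definition word_conv ::
    "('m, 'b) monoid_scheme \<Rightarrow> 'x semigroup_rec \<Rightarrow> ('m \<Rightarrow> 'x \<rightharpoonup> 'x) \<Rightarrow>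
     (('m \<times> 'x) set list \<times> ('m \<times> 'x) set list) set" where
  "word_conv M X \<alpha> = equiv_closure (carrier (XM_words M X \<alpha>)) (word_step M X \<alpha>)"

definition beta_bar_semigroup ::
    "('m, 'b) monoid_scheme \<Rightarrow> 'x semigroup_rec \<Rightarrow> ('m \<Rightarrow> 'x \<rightharpoonup> 'x) \<Rightarrow>
     ('m \<times> 'x) set list set semigroup_rec" where
  "beta_bar_semigroup M X \<alpha> = quotient_semigroup (XM_words M X \<alpha>) (R_sharp M X \<alpha>)"

text \<open>
  \<open>XM_shift n\<close> is the map \<open>[m, x] \<mapsto> [nm, x]\<close> on \<open>X\<^sub>M\<close>; it is applied letter by letter to
  words. In this map and in \<open>beta_bar\<close> the union over representatives is a single class,
  because the map does not depend on the representative.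
\<close>

definition XM_shift ::
    "('m, 'b) monoid_scheme \<Rightarrow> 'x semigroup_rec \<Rightarrow> ('m \<Rightarrow> 'x \<rightharpoonup> 'x) \<Rightarrow>
     'm \<Rightarrow> ('m \<times> 'x) set \<Rightarrow> ('m \<times> 'x) set" where
  "XM_shift M X \<alpha> n U = (\<Union>(m, x)\<in>U. XM_class M X \<alpha> (n \<otimes>\<^bsub>M\<^esub> m) x)"

definition beta_bar ::
    "('m, 'b) monoid_scheme \<Rightarrow> 'x semigroup_rec \<Rightarrow> ('m \<Rightarrow> 'x \<rightharpoonup> 'x) \<Rightarrow>
     'm \<Rightarrow> ('m \<times> 'x) set list set \<rightharpoonup> ('m \<times> 'x) set list set" where
  "beta_bar M X \<alpha> n W =
     (if W \<in> carrier (beta_bar_semigroup M X \<alpha>)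
      then Some (\<Union>w\<in>W. R_sharp M X \<alpha> `` {map (XM_shift M X \<alpha> n) w})
      else None)"

definition iota_bar ::
    "('m, 'b) monoid_scheme \<Rightarrow> 'x semigroup_rec \<Rightarrow> ('m \<Rightarrow> 'x \<rightharpoonup> 'x) \<Rightarrow>
     'x \<Rightarrow> ('m \<times> 'x) set list set" where
  "iota_bar M X \<alpha> x = R_sharp M X \<alpha> `` {[XM_class M X \<alpha> \<one>\<^bsub>M\<^esub> x]}"

end

theory Submission
  imports Defs
begin

text \<open>
  By the axioms of a strong partial action, the partial map \<open>(m, x) \<mapsto> \<alpha>\<^sub>m x\<close> is constant on
  the classes of \<open>\<approx>\<close>, so \<open>[m, x] = [e, y]\<close> holds in \<open>X\<^sub>M\<close> exactly when \<open>\<alpha>\<^sub>m x = y\<close>. The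
  congruence \<open>R\<^sup>#\<close> coincides with \<open>\<leftrightarrow>\<^sup>*\<close>, so \<open>[m, x] \<leftrightarrow>\<^sup>* [e, y]\<close> says that \<open>\<beta>\<close> sends
  \<open>\<iota> x\<close> to \<open>\<iota> y\<close>; hence the condition on words is the defining property of a globalization.
  Universality is then automatic: for a globalization \<open>(\<gamma>, \<kappa>)\<close> the map
  \<open>[m, x] \<mapsto> \<gamma>\<^sub>m (\<kappa> x)\<close> respects \<open>\<approx>\<close>, and its multiplicative extension to words respects
  \<open>R\<close>. It is the only candidate, since the elements \<open>[m, x] = \<beta>\<^sub>m (\<iota> x)\<close> generate.
\<close>

section \<open>Generated equivalences and congruences\<close>

text \<open>Used to pull conversion of words back along insertion into a fixed context, so that
  minimality of the closure applies there.\<close>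

lemma equiv_preimage:
  assumes "equiv B s" and "f \<in> A \<rightarrow> B"
  shows "equiv A {(x, y). x \<in> A \<and> y \<in> A \<and> (f x, f y) \<in> s}"
proof (rule equivI)
  show "refl_on A {(x, y). x \<in> A \<and> y \<in> A \<and> (f x, f y) \<in> s}"
    using assms by (fastforce simp: refl_on_def equiv_def)
  show "sym {(x, y). x \<in> A \<and> y \<in> A \<and> (f x, f y) \<in> s}"
    using assms by (fastforce simp: sym_def equiv_def)
  show "trans {(x, y). x \<in> A \<and> y \<in> A \<and> (f x, f y) \<in> s}"
    using assms unfolding trans_def equiv_def by blast
qed auto

text \<open>Paired with \<open>equiv_closure_least\<close> this is the induction principle for a
  generated equivalence: a map constant on generating pairs is constant on classes.\<close>

lemma equiv_kernel: "equiv A {(x, y). x \<in> A \<and> y \<in> A \<and> f x = f y}"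
  by (rule equivI) (auto simp: refl_on_def sym_def trans_def)

lemma equiv_closure_least: "equiv A s \<Longrightarrow> r \<subseteq> s \<Longrightarrow> equiv_closure A r \<subseteq> s"
  by (auto simp: equiv_closure_def)

lemma equiv_closure_superset: "r \<subseteq> equiv_closure A r"
  by (auto simp: equiv_closure_def)

text \<open>The hypothesis makes \<open>A \<times> A\<close> one of the intersected equivalences,
  which keeps the closure inside \<open>A \<times> A\<close>.\<close>

lemma equiv_equiv_closure:
  assumes "r \<subseteq> A \<times> A"
  shows "equiv A (equiv_closure A r)"
proof (rule equivI)
  have "equiv A (A \<times> A)"
    by (rule equivI) (auto simp: refl_on_def sym_def trans_def)
  then show "equiv_closure A r \<subseteq> A \<times> A"
    using assms by (rule equiv_closure_least)
  show "refl_on A (equiv_closure A r)"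
    by (auto simp: equiv_closure_def refl_on_def equiv_def)
  show "sym (equiv_closure A r)"
    by (auto simp: equiv_closure_def sym_def equiv_def)
  show "trans (equiv_closure A r)"
    unfolding equiv_closure_def trans_def equiv_def by blast
qed

lemma congruence_closure_least:
  "congruence_on S s \<Longrightarrow> r \<subseteq> s \<Longrightarrow> congruence_closure S r \<subseteq> s"
  by (auto simp: congruence_closure_def)

lemma congruence_closure_superset: "r \<subseteq> congruence_closure S r"
  by (auto simp: congruence_closure_def)

lemma congruence_onD:
  assumes "congruence_on S r"
  shows "equiv (carrier S) r"
    and "(a, b) \<in> r \<Longrightarrow> (c, d) \<in> r \<Longrightarrow> (a \<odot>\<^bsub>S\<^esub> c, b \<odot>\<^bsub>S\<^esub> d) \<in> r"
  using assms by (auto simp: congruence_on_def)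

text \<open>All properties pass to intersections; closure of \<open>S\<close> under products makes
  the total relation a congruence, which bounds the intersection.\<close>

lemma congruence_on_congruence_closure:
  assumes "semigrp S" and "r \<subseteq> carrier S \<times> carrier S"
  shows "congruence_on S (congruence_closure S r)"
  unfolding congruence_on_def
proof (intro conjI allI impI)
  let ?c = "congruence_closure S r" and ?A = "carrier S"
  have memI: "p \<in> ?c" if "\<And>s. congruence_on S s \<Longrightarrow> r \<subseteq> s \<Longrightarrow> p \<in> s" for p
    using that by (auto simp: congruence_closure_def)
  have memD: "p \<in> s" if "p \<in> ?c" "congruence_on S s" "r \<subseteq> s" for p s
    using that by (auto simp: congruence_closure_def)
  show "equiv ?A ?c"
  proof (rule equivI)
    have "equiv ?A (?A \<times> ?A)"
      by (rule equivI) (auto simp: refl_on_def sym_def trans_def)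
    then have "congruence_on S (?A \<times> ?A)"
      by (simp add: congruence_on_def semigrp.smult_closed[OF assms(1)])
    then show "?c \<subseteq> ?A \<times> ?A"
      using assms(2) by (rule congruence_closure_least)
    show "refl_on ?A ?c"
      by (intro refl_onI memI) (auto simp: congruence_on_def equiv_def dest: refl_onD)
    show "sym ?c"
    proof (intro symI memI)
      fix a b s assume "(a, b) \<in> ?c" and s: "congruence_on S s" "r \<subseteq> s"
      then have "(a, b) \<in> s" by (rule memD)
      with s(1) show "(b, a) \<in> s" by (auto simp: congruence_on_def equiv_def dest: symD)
    qed
    show "trans ?c"
    proof (intro transI memI)
      fix a b d s
      assume "(a, b) \<in> ?c" "(b, d) \<in> ?c" and s: "congruence_on S s" "r \<subseteq> s"
      then have "(a, b) \<in> s" "(b, d) \<in> s" by (simp_all add: memD)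
      with s(1) show "(a, d) \<in> s" by (auto simp: congruence_on_def equiv_def dest: transD)
    qed
  qed
  fix a b c d
  assume "(a, b) \<in> ?c" "(c, d) \<in> ?c"
  then show "(a \<odot>\<^bsub>S\<^esub> c, b \<odot>\<^bsub>S\<^esub> d) \<in> ?c"
    by (intro memI) (simp add: congruence_onD(2) memD)
qed

lemma semigroup_homD:
  assumes "h \<in> semigroup_hom S T"
  shows "x \<in> carrier S \<Longrightarrow> h x \<in> carrier T"
    and "x \<in> carrier S \<Longrightarrow> y \<in> carrier S \<Longrightarrow> h (x \<odot>\<^bsub>S\<^esub> y) = h x \<odot>\<^bsub>T\<^esub> h y"
  using assms by (auto simp: semigroup_hom_def)

lemma congruence_on_kernel:
  assumes "semigrp S" and "h \<in> semigroup_hom S T"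
  shows "congruence_on S {(x, y). x \<in> carrier S \<and> y \<in> carrier S \<and> h x = h y}"
  unfolding congruence_on_def
  using equiv_kernel[of "carrier S" h] semigrp.smult_closed[OF assms(1)]
    semigroup_homD(2)[OF assms(2)]
  by auto

section \<open>Quotient of a semigroup by a congruence\<close>

context
  fixes S :: "'a semigroup_rec" and r :: "('a \<times> 'a) set"
  assumes S: "semigrp S" and r: "congruence_on S r"
begin

text \<open>By compatibility all members of the double union are the same class, and the union is
  nonempty since each class contains its representative.\<close>

lemma quotient_smult:
  assumes "a \<in> carrier S" and "b \<in> carrier S"
  shows "r `` {a} \<odot>\<^bsub>quotient_semigroup S r\<^esub> r `` {b} = r `` {a \<odot>\<^bsub>S\<^esub> b}"
proof -
  have "r `` {u \<odot>\<^bsub>S\<^esub> v} = r `` {a \<odot>\<^bsub>S\<^esub> b}" if "u \<in> r `` {a}" "v \<in> r `` {b}" for u v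
    using that congruence_onD[OF r] by (intro equiv_class_eq[symmetric]) auto
  moreover have "a \<in> r `` {a}" "b \<in> r `` {b}"
    using assms by (simp_all only: equiv_class_self[OF congruence_onD(1)[OF r]])
  ultimately have "(\<Union>u\<in>r `` {a}. \<Union>v\<in>r `` {b}. r `` {u \<odot>\<^bsub>S\<^esub> v}) = r `` {a \<odot>\<^bsub>S\<^esub> b}"
    by blast
  then show ?thesis
    by (simp add: quotient_semigroup_def)
qed

lemma quotient_carrier: "carrier (quotient_semigroup S r) = (\<lambda>a. r `` {a}) ` carrier S"
  by (auto simp: quotient_semigroup_def quotient_def)

lemma quotient_eq_iff:
  assumes "a \<in> carrier S" and "b \<in> carrier S"
  shows "r `` {a} = r `` {b} \<longleftrightarrow> (a, b) \<in> r"
  using assms by (simp add: eq_equiv_class_iff[OF congruence_onD(1)[OF r]])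

lemma semigrp_quotient: "semigrp (quotient_semigroup S r)"
  by unfold_locales
    (auto simp: quotient_carrier quotient_smult semigrp.smult_closed[OF S]
      semigrp.smult_assoc[OF S])

lemma semigroup_hom_quotientI:
  assumes "h \<in> semigroup_hom S T" and "\<And>a. a \<in> carrier S \<Longrightarrow> f (r `` {a}) = h a"
  shows "f \<in> semigroup_hom (quotient_semigroup S r) T"
  using assms(2) semigroup_homD[OF assms(1)] semigrp.smult_closed[OF S]
  by (auto simp: semigroup_hom_def quotient_carrier quotient_smult)

end

section \<open>Free semigroups\<close>

lemma free_semigroup_simps:
  "w \<in> carrier (free_semigroup A) \<longleftrightarrow> w \<in> lists A \<and> w \<noteq> []"
  "u \<odot>\<^bsub>free_semigroup A\<^esub> v = u @ v"
  by (auto simp: free_semigroup_def)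

lemma semigrp_free_semigroup: "semigrp (free_semigroup A)"
  by unfold_locales (auto simp: free_semigroup_simps)

text \<open>Without a unit the recursion starts at one-letter words; the value at the empty word is
  left unspecified, hence the nonemptiness assumptions that follow.\<close>

fun semigroup_prod :: "'a semigroup_rec \<Rightarrow> 'a list \<Rightarrow> 'a" where
  "semigroup_prod S [a] = a"
| "semigroup_prod S (a # b # w) = a \<odot>\<^bsub>S\<^esub> semigroup_prod S (b # w)"

lemma semigroup_prod_Cons:
  "w \<noteq> [] \<Longrightarrow> semigroup_prod S (a # w) = a \<odot>\<^bsub>S\<^esub> semigroup_prod S w"
  by (cases w) auto

lemma semigroup_prod_closed:
  assumes "semigrp S" and "w \<in> lists (carrier S)" and "w \<noteq> []"
  shows "semigroup_prod S w \<in> carrier S"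
  using assms(3,2)
  by (induction w rule: list_nonempty_induct)
    (auto simp: semigroup_prod_Cons semigrp.smult_closed[OF assms(1)])

lemma semigroup_prod_append:
  assumes "semigrp S" and "u \<in> lists (carrier S)" and "u \<noteq> []"
    and "v \<in> lists (carrier S)" and "v \<noteq> []"
  shows "semigroup_prod S (u @ v) = semigroup_prod S u \<odot>\<^bsub>S\<^esub> semigroup_prod S v"
  using assms(3,2)
proof (induction u rule: list_nonempty_induct)
  case (single a)
  then show ?case using assms(5) by (simp add: semigroup_prod_Cons)
next
  case (cons a u)
  then show ?case
    using assms semigroup_prod_closed[OF assms(1)]
    by (auto simp: semigroup_prod_Cons semigrp.smult_assoc[OF assms(1)])
qed

text \<open>The existence half of the universal property of the free semigroup on
  \<open>A\<close>.\<close>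

lemma semigroup_prod_map_hom:
  assumes "semigrp S" and "g \<in> A \<rightarrow> carrier S"
  shows "(\<lambda>w. semigroup_prod S (map g w)) \<in> semigroup_hom (free_semigroup A) S"
proof -
  have "map g w \<in> lists (carrier S)" if "w \<in> lists A" for w
    using that assms(2) by (auto simp: Pi_iff)
  then show ?thesis
    by (simp add: semigroup_hom_def free_semigroup_simps semigroup_prod_closed[OF assms(1)]
        semigroup_prod_append[OF assms(1)] del: in_lists_conv_set)
qed

lemma semigroup_hom_semigroup_prod:
  assumes "semigrp S" and "h \<in> semigroup_hom S T" and "w \<in> lists (carrier S)" and "w \<noteq> []"
  shows "h (semigroup_prod S w) = semigroup_prod T (map h w)"
  using assms(4,3)
  by (induction w rule: list_nonempty_induct)
    (auto simp: semigroup_prod_Cons semigroup_homD(2)[OF assms(2)]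
      semigroup_prod_closed[OF assms(1)])

section \<open>Global actions\<close>

text \<open>As an equation between options this records both strong axioms at once: if
  \<open>y\<close> is outside the domain of \<open>\<alpha> n\<close>, the preimage axiom makes both
  sides undefined; otherwise the composition axiom gives the common value.\<close>

lemma strong_partial_action_on_set_mult:
  assumes "strong_partial_action_on_set M A \<alpha>"
    and "m \<in> carrier M" and "n \<in> carrier M" and "\<alpha> m x = Some y"
  shows "\<alpha> (n \<otimes>\<^bsub>M\<^esub> m) x = \<alpha> n y"
proof -
  have vim: "\<alpha> m -` (Some ` dom (\<alpha> n)) = dom (\<alpha> (n \<otimes>\<^bsub>M\<^esub> m)) \<inter> dom (\<alpha> m)"
    using assms by (simp add: strong_partial_action_on_set_def)
  have comp: "(\<alpha> n \<circ>\<^sub>m \<alpha> m) x = \<alpha> (n \<otimes>\<^bsub>M\<^esub> m) x" if "x \<in> \<alpha> m -` (Some ` dom (\<alpha> n))"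
    using assms(1-3) that unfolding strong_partial_action_on_set_def by blast
  have "x \<in> \<alpha> m -` (Some ` dom (\<alpha> n)) \<longleftrightarrow> y \<in> dom (\<alpha> n)"
    using assms(4) by auto
  with vim comp assms(4) show ?thesis
    by (cases "y \<in> dom (\<alpha> n)") (auto simp: domIff)
qed

text \<open>For total maps both sides of the preimage axiom are the whole carrier, so the
  composition law carries all that remains of the two strong axioms.\<close>

lemma global_actionI:
  fixes Y :: "'y semigroup_rec" and \<beta> :: "'m \<Rightarrow> 'y \<rightharpoonup> 'y"
  assumes "monoid M" and "semigrp Y"
    and dom: "\<And>m. m \<in> carrier M \<Longrightarrow> dom (\<beta> m) = carrier Y"
    and hom: "\<And>m. m \<in> carrier M \<Longrightarrow> (\<lambda>x. the (\<beta> m x)) \<in> semigroup_hom Y Y"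
    and one: "\<And>x. x \<in> carrier Y \<Longrightarrow> \<beta> \<one>\<^bsub>M\<^esub> x = Some x"
    and mult: "\<And>m n x. m \<in> carrier M \<Longrightarrow> n \<in> carrier M \<Longrightarrow> x \<in> carrier Y \<Longrightarrow>
      \<beta> n (the (\<beta> m x)) = \<beta> (n \<otimes>\<^bsub>M\<^esub> m) x"
  shows "global_action M Y \<beta>"
proof -
  interpret monoid M by fact
  have val: "\<exists>y\<in>carrier Y. \<beta> m x = Some y" if "m \<in> carrier M" "x \<in> carrier Y" for m x
  proof -
    have "x \<in> dom (\<beta> m)" using that by (simp add: dom)
    then obtain y where "\<beta> m x = Some y" by blast
    then show ?thesis using semigroup_homD(1)[OF hom, of m x] that by simp
  qed
  have arg: "x \<in> carrier Y" if "m \<in> carrier M" "\<beta> m x = Some y" for m x y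
    using that dom[of m] by blast
  have ran: "ran (\<beta> m) \<subseteq> carrier Y" if m: "m \<in> carrier M" for m
  proof
    fix y assume "y \<in> ran (\<beta> m)"
    then obtain x where "\<beta> m x = Some y" by (auto simp: ran_def)
    with val[OF m arg[OF m this]] show "y \<in> carrier Y" by simp
  qed
  have "strong_partial_action_on_set M (carrier Y) \<beta>"
    unfolding strong_partial_action_on_set_def
  proof (intro conjI ballI)
    fix m n x assume mn: "m \<in> carrier M" "n \<in> carrier M"
      and "x \<in> \<beta> m -` (Some ` dom (\<beta> n))"
    then obtain y where y: "\<beta> m x = Some y" by auto
    with mult[OF mn arg[OF mn(1) y]] show "(\<beta> n \<circ>\<^sub>m \<beta> m) x = \<beta> (n \<otimes>\<^bsub>M\<^esub> m) x"
      by simp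
  next
    fix m n assume mn: "m \<in> carrier M" "n \<in> carrier M"
    have "\<beta> m -` (Some ` carrier Y) = carrier Y"
      using arg[OF mn(1)] val[OF mn(1)] by blast
    with mn show "\<beta> m -` (Some ` dom (\<beta> n)) = dom (\<beta> (n \<otimes>\<^bsub>M\<^esub> m)) \<inter> dom (\<beta> m)"
      by (simp add: dom)
  qed (simp_all add: dom ran one)
  then show ?thesis
    using dom hom semigrp.smult_closed[OF assms(2)]
    by (simp add: global_action_def strong_partial_action_def subsemigroup_def)
qed

lemma global_actionD:
  fixes Y :: "'y semigroup_rec" and \<beta> :: "'m \<Rightarrow> 'y \<rightharpoonup> 'y"
  assumes "global_action M Y \<beta>"
  shows "m \<in> carrier M \<Longrightarrow> x \<in> carrier Y \<Longrightarrow> \<beta> m x = Some (the (\<beta> m x))"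
    and "m \<in> carrier M \<Longrightarrow> (\<lambda>x. the (\<beta> m x)) \<in> semigroup_hom Y Y"
    and "x \<in> carrier Y \<Longrightarrow> \<beta> \<one>\<^bsub>M\<^esub> x = Some x"
    and "m \<in> carrier M \<Longrightarrow> n \<in> carrier M \<Longrightarrow> x \<in> carrier Y \<Longrightarrow>
      \<beta> n (the (\<beta> m x)) = \<beta> (n \<otimes>\<^bsub>M\<^esub> m) x"
proof -
  have set: "strong_partial_action_on_set M (carrier Y) \<beta>"
    and dom: "\<And>m. m \<in> carrier M \<Longrightarrow> dom (\<beta> m) = carrier Y"
    and hom: "\<And>m. m \<in> carrier M \<Longrightarrow>
      (\<lambda>x. the (\<beta> m x)) \<in> semigroup_hom (Y\<lparr>carrier := dom (\<beta> m)\<rparr>) Y"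
    using assms by (auto simp: global_action_def strong_partial_action_def)
  show val: "m \<in> carrier M \<Longrightarrow> x \<in> carrier Y \<Longrightarrow> \<beta> m x = Some (the (\<beta> m x))" for m x
    using dom by force
  show hom': "m \<in> carrier M \<Longrightarrow> (\<lambda>x. the (\<beta> m x)) \<in> semigroup_hom Y Y" for m
    using hom[of m] dom[of m] by simp
  show "x \<in> carrier Y \<Longrightarrow> \<beta> \<one>\<^bsub>M\<^esub> x = Some x"
    using set by (simp add: strong_partial_action_on_set_def)
  assume m: "m \<in> carrier M" and n: "n \<in> carrier M" and x: "x \<in> carrier Y"
  show "\<beta> n (the (\<beta> m x)) = \<beta> (n \<otimes>\<^bsub>M\<^esub> m) x"
    using strong_partial_action_on_set_mult[OF set m n val[OF m x]] by simp
qed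

section \<open>The semigroup of a strong partial action\<close>

locale semigroup_partial_action = monoid M
  for M :: "('m, 'b) monoid_scheme" (structure) +
  fixes X :: "'x semigroup_rec" and \<alpha> :: "'m \<Rightarrow> 'x \<rightharpoonup> 'x"
  assumes semigrp_X: "semigrp X" and partial_action: "strong_partial_action M X \<alpha>"
begin

lemma partial_action_closed:
  assumes "m \<in> carrier M" and "\<alpha> m x = Some y"
  shows "x \<in> carrier X" and "y \<in> carrier X"
  using partial_action assms
  by (auto simp: strong_partial_action_def strong_partial_action_on_set_def ran_def)

lemma partial_action_one: "x \<in> carrier X \<Longrightarrow> \<alpha> \<one> x = Some x"
  using partial_action
  by (simp add: strong_partial_action_def strong_partial_action_on_set_def)

lemma partial_action_mult:
  assumes "m \<in> carrier M" and "n \<in> carrier M" and "\<alpha> m x = Some y"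
  shows "\<alpha> (n \<otimes> m) x = \<alpha> n y"
  using partial_action assms
  by (intro strong_partial_action_on_set_mult) (auto simp: strong_partial_action_def)

abbreviation "cls \<equiv> XM_class M X \<alpha>"
abbreviation "words \<equiv> XM_words M X \<alpha>"
abbreviation "R\<^sub>c \<equiv> R_sharp M X \<alpha>"
abbreviation "Q \<equiv> beta_bar_semigroup M X \<alpha>"
abbreviation "\<beta> \<equiv> beta_bar M X \<alpha>"
abbreviation "\<iota> \<equiv> iota_bar M X \<alpha>"
abbreviation "shift \<equiv> XM_shift M X \<alpha>"

section \<open>The set X_M, its classes and the shift maps\<close>

lemma equiv_XM_rel: "equiv (carrier M \<times> carrier X) (XM_rel M X \<alpha>)"
  unfolding XM_rel_def by (rule equiv_equiv_closure) (auto simp: XM_step_def)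

lemma XM_eq_image: "XM M X \<alpha> = (\<lambda>(m, x). cls m x) ` (carrier M \<times> carrier X)"
  by (auto simp: XM_def quotient_def XM_class_def)

lemma cls_in_XM: "m \<in> carrier M \<Longrightarrow> x \<in> carrier X \<Longrightarrow> cls m x \<in> XM M X \<alpha>"
  by (auto simp: XM_eq_image)

lemma XM_cases:
  assumes "U \<in> XM M X \<alpha>"
  obtains m x where "m \<in> carrier M" and "x \<in> carrier X" and "U = cls m x"
  using assms by (auto simp: XM_eq_image)

lemma cls_self: "m \<in> carrier M \<Longrightarrow> x \<in> carrier X \<Longrightarrow> (m, x) \<in> cls m x"
  unfolding XM_class_def using equiv_XM_rel by (rule equiv_class_self) simp

lemma cls_step:
  assumes "n \<in> carrier M" and "k \<in> carrier M" and "\<alpha> k x = Some y"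
  shows "cls (n \<otimes> k) x = cls n y"
proof -
  have "((n \<otimes> k, x), (n, y)) \<in> XM_step M X \<alpha>"
    using assms partial_action_closed[OF assms(2,3)] by (auto simp: XM_step_def)
  then have "((n \<otimes> k, x), (n, y)) \<in> XM_rel M X \<alpha>"
    unfolding XM_rel_def using equiv_closure_superset by blast
  then show ?thesis
    unfolding XM_class_def by (rule equiv_class_eq[OF equiv_XM_rel])
qed

text \<open>The kernel of \<open>f\<close> on pairs is an equivalence containing every generating
  step, hence contains \<approx>.\<close>

lemma cls_cong:
  assumes step: "\<And>n k x y. n \<in> carrier M \<Longrightarrow> k \<in> carrier M \<Longrightarrow> \<alpha> k x = Some y \<Longrightarrow>
      f (n \<otimes> k) x = f n y"
    and "(m, x) \<in> cls n y"
  shows "f m x = f n y"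
proof -
  let ?A = "carrier M \<times> carrier X"
  have "XM_rel M X \<alpha> \<subseteq>
      {(p, q). p \<in> ?A \<and> q \<in> ?A \<and> (\<lambda>(m, x). f m x) p = (\<lambda>(m, x). f m x) q}"
    unfolding XM_rel_def
    by (rule equiv_closure_least[OF equiv_kernel]) (auto simp: XM_step_def step)
  with assms(2) show ?thesis
    unfolding XM_class_def by auto
qed

text \<open>The singleton form evaluates both unions over representatives and
  \<open>the_elem\<close> of an image.\<close>

lemma UN_cls:
  assumes "\<And>n k x y. n \<in> carrier M \<Longrightarrow> k \<in> carrier M \<Longrightarrow> \<alpha> k x = Some y \<Longrightarrow>
      f (n \<otimes> k) x = f n y"
    and "m \<in> carrier M" and "x \<in> carrier X"
  shows "(\<lambda>(n, y). f n y) ` cls m x = {f m x}"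
proof -
  have "f n y = f m x" if "(n, y) \<in> cls m x" for n y
    using assms(1) that by (rule cls_cong)
  then have "(\<lambda>(n, y). f n y) ` cls m x \<subseteq> {f m x}"
    by auto
  moreover have "f m x \<in> (\<lambda>(n, y). f n y) ` cls m x"
    using cls_self[OF assms(2,3)] by (rule rev_image_eqI) simp
  ultimately show ?thesis
    by blast
qed

lemma cls_eq_one_iff:
  assumes "m \<in> carrier M" and "x \<in> carrier X" and "y \<in> carrier X"
  shows "cls m x = cls \<one> y \<longleftrightarrow> \<alpha> m x = Some y"
proof
  assume "cls m x = cls \<one> y"
  then have "(m, x) \<in> cls \<one> y"
    using cls_self[OF assms(1,2)] by simp
  \<comment> \<open>\<open>cls_cong\<close> is applied to \<open>\<alpha>\<close> itself: the option
    value, undefinedness included, is invariant along steps.\<close>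
  then have "\<alpha> m x = \<alpha> \<one> y"
    by (rule cls_cong[rotated]) (simp add: partial_action_mult)
  with assms(3) show "\<alpha> m x = Some y"
    by (simp add: partial_action_one)
next
  assume "\<alpha> m x = Some y"
  with assms(1) cls_step[of \<one> m x y] show "cls m x = cls \<one> y"
    by simp
qed

text \<open>Steps of \<approx> change the monoid component on the right, so left multiplication by
  \<open>n\<close> respects them by associativity.\<close>

lemma shift_cls:
  assumes "n \<in> carrier M" and "m \<in> carrier M" and "x \<in> carrier X"
  shows "shift n (cls m x) = cls (n \<otimes> m) x"
proof -
  have "(\<lambda>(m, x). cls (n \<otimes> m) x) ` cls m x = {cls (n \<otimes> m) x}"
    using assms by (intro UN_cls) (simp_all add: cls_step flip: m_assoc)
  then show ?thesis
    by (simp add: XM_shift_def)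
qed

lemma shift_closed: "n \<in> carrier M \<Longrightarrow> U \<in> XM M X \<alpha> \<Longrightarrow> shift n U \<in> XM M X \<alpha>"
  by (auto elim!: XM_cases simp: shift_cls cls_in_XM)

section \<open>The congruence R^# and maps constant on its classes\<close>

lemma congruence_R_sharp: "congruence_on words R\<^sub>c"
  unfolding R_sharp_def
  by (rule congruence_on_congruence_closure[OF semigrp_free_semigroup])
    (auto simp: free_semigroup_simps cls_in_XM semigrp.smult_closed[OF semigrp_X])

lemma R_class_eq: "(u, v) \<in> R\<^sub>c \<Longrightarrow> R\<^sub>c `` {u} = R\<^sub>c `` {v}"
  by (rule equiv_class_eq[OF congruence_onD(1)[OF congruence_R_sharp]])

lemma R_sharp_generator:
  assumes "m \<in> carrier M" and "x \<in> carrier X" and "y \<in> carrier X"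
  shows "([cls m x, cls m y], [cls m (x \<odot>\<^bsub>X\<^esub> y)]) \<in> R\<^sub>c"
  unfolding R_sharp_def using assms by (intro subsetD[OF congruence_closure_superset]) blast

text \<open>The kernel of \<open>h\<close> is a congruence containing the generating pairs, hence
  contains the least one.\<close>

lemma R_sharp_subset_kernel:
  assumes hom: "h \<in> semigroup_hom words T"
    and gen: "\<And>m x y. m \<in> carrier M \<Longrightarrow> x \<in> carrier X \<Longrightarrow> y \<in> carrier X \<Longrightarrow>
      h [cls m x, cls m y] = h [cls m (x \<odot>\<^bsub>X\<^esub> y)]"
    and "(u, v) \<in> R\<^sub>c"
  shows "h u = h v"
proof -
  have "R\<^sub>c \<subseteq> {(x, y). x \<in> carrier words \<and> y \<in> carrier words \<and> h x = h y}"
    unfolding R_sharp_def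
    by (rule congruence_closure_least[OF congruence_on_kernel[OF semigrp_free_semigroup hom]])
      (auto simp: gen free_semigroup_simps cls_in_XM semigrp.smult_closed[OF semigrp_X])
  with assms(3) show ?thesis by auto
qed

text \<open>The analogue of \<open>UN_cls\<close> for words: a map defined through representatives
  of an R^#-class can be evaluated at any chosen word.\<close>

lemma image_R_class:
  assumes "h \<in> semigroup_hom words T"
    and "\<And>m x y. m \<in> carrier M \<Longrightarrow> x \<in> carrier X \<Longrightarrow> y \<in> carrier X \<Longrightarrow>
      h [cls m x, cls m y] = h [cls m (x \<odot>\<^bsub>X\<^esub> y)]"
    and "w \<in> carrier words"
  shows "h ` (R\<^sub>c `` {w}) = {h w}"
proof -
  have "h v = h w" if "v \<in> R\<^sub>c `` {w}" for v
  proof (rule R_sharp_subset_kernel[OF assms(1,2), symmetric])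
    show "(w, v) \<in> R\<^sub>c" using that by simp
  qed
  then have "h ` (R\<^sub>c `` {w}) \<subseteq> {h w}"
    by blast
  moreover have "w \<in> R\<^sub>c `` {w}"
    using congruence_onD(1)[OF congruence_R_sharp] assms(3) by (rule equiv_class_self)
  ultimately show ?thesis by blast
qed

section \<open>Conversion of words agrees with R^#\<close>

lemma word_step_subset: "word_step M X \<alpha> \<subseteq> carrier words \<times> carrier words"
  by (auto simp: word_step_def free_semigroup_simps cls_in_XM
      semigrp.smult_closed[OF semigrp_X])

lemma equiv_word_conv: "equiv (carrier words) (word_conv M X \<alpha>)"
  unfolding word_conv_def using word_step_subset by (rule equiv_equiv_closure)

lemma word_conv_context:
  assumes "p \<in> lists (XM M X \<alpha>)" and "q \<in> lists (XM M X \<alpha>)" and "(u, v) \<in> word_conv M X \<alpha>"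
  shows "(p @ u @ q, p @ v @ q) \<in> word_conv M X \<alpha>"
proof -
  have "(p @ u @ q, p @ v @ q) \<in> word_conv M X \<alpha>" if "(u, v) \<in> word_step M X \<alpha>" for u v
  proof -
    from that obtain u' v' m x y where uv: "u = u' @ [cls m x, cls m y] @ v'"
      "v = u' @ [cls m (x \<odot>\<^bsub>X\<^esub> y)] @ v'" "u' \<in> lists (XM M X \<alpha>)" "v' \<in> lists (XM M X \<alpha>)"
      "m \<in> carrier M" "x \<in> carrier X" "y \<in> carrier X"
      unfolding word_step_def by blast
    \<comment> \<open>The context is absorbed into the words surrounding the rewritten letters, so
      the result is again a single step.\<close>
    have "p @ u' \<in> lists (XM M X \<alpha>)" "v' @ q \<in> lists (XM M X \<alpha>)"
      using uv assms(1,2) by simp_all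
    then have "((p @ u') @ [cls m x, cls m y] @ (v' @ q),
        (p @ u') @ [cls m (x \<odot>\<^bsub>X\<^esub> y)] @ (v' @ q)) \<in> word_step M X \<alpha>"
      unfolding word_step_def using uv(5-7) by blast
    then show ?thesis
      unfolding word_conv_def uv(1,2) using equiv_closure_superset by fastforce
  qed
  moreover have "(\<lambda>u. p @ u @ q) \<in> carrier words \<rightarrow> carrier words"
    using assms(1,2) by (auto simp: free_semigroup_simps)
  \<comment> \<open>The right-hand side is the pullback of conversion along
    \<open>\<lambda>u. p @ u @ q\<close>, an equivalence containing all steps.\<close>
  ultimately have "word_conv M X \<alpha> \<subseteq>
      {(u, v). u \<in> carrier words \<and> v \<in> carrier words \<and>
        (p @ u @ q, p @ v @ q) \<in> word_conv M X \<alpha>}"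
    using word_step_subset equiv_preimage[OF equiv_word_conv]
    by (subst word_conv_def, intro equiv_closure_least) auto
  with assms(3) show ?thesis by auto
qed

text \<open>Two one-sided replacements, \<open>a @ c\<close> to \<open>b @ c\<close> to
  \<open>b @ d\<close>, are joined by transitivity.\<close>

lemma congruence_word_conv: "congruence_on words (word_conv M X \<alpha>)"
  unfolding congruence_on_def
proof (intro conjI allI impI equiv_word_conv)
  fix a b c d
  assume ab: "(a, b) \<in> word_conv M X \<alpha>" and cd: "(c, d) \<in> word_conv M X \<alpha>"
  moreover have "word_conv M X \<alpha> \<subseteq> carrier words \<times> carrier words"
    using equiv_word_conv by (rule equivE)
  ultimately have "b \<in> carrier words" "c \<in> carrier words"
    by blast+
  then have "b \<in> lists (XM M X \<alpha>)" "c \<in> lists (XM M X \<alpha>)"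
    by (simp_all add: free_semigroup_simps)
  with word_conv_context[OF _ _ ab, of "[]" c] word_conv_context[OF _ _ cd, of b "[]"]
  have "(a @ c, b @ c) \<in> word_conv M X \<alpha>" "(b @ c, b @ d) \<in> word_conv M X \<alpha>"
    by simp_all
  then show "(a \<odot>\<^bsub>words\<^esub> c, b \<odot>\<^bsub>words\<^esub> d) \<in> word_conv M X \<alpha>"
    using equiv_word_conv by (auto simp: free_semigroup_simps equiv_def dest: transD)
qed

text \<open>A congruence on the free semigroup multiplies nonempty words only, so an empty
  \<open>u\<close> or \<open>v\<close> is a separate case.\<close>

lemma R_sharp_context:
  assumes "u \<in> lists (XM M X \<alpha>)" and "v \<in> lists (XM M X \<alpha>)" and "(a, b) \<in> R\<^sub>c"
  shows "(u @ a @ v, u @ b @ v) \<in> R\<^sub>c"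
proof -
  have refl: "(w, w) \<in> R\<^sub>c" if "w \<in> lists (XM M X \<alpha>)" "w \<noteq> []" for w
    using that congruence_onD(1)[OF congruence_R_sharp]
    by (auto simp: equiv_def refl_on_def free_semigroup_simps)
  have "(a @ v, b @ v) \<in> R\<^sub>c"
    using congruence_onD(2)[OF congruence_R_sharp assms(3) refl[of v]] assms
    by (cases "v = []") (auto simp: free_semigroup_simps)
  then show ?thesis
    using congruence_onD(2)[OF congruence_R_sharp refl[of u]] assms
    by (cases "u = []") (auto simp: free_semigroup_simps)
qed

text \<open>Two minimality arguments: conversion is a congruence containing the generating pairs,
  and R^# is an equivalence containing every step.\<close>

lemma R_sharp_eq_word_conv: "R\<^sub>c = word_conv M X \<alpha>"
proof
  have "([cls m x, cls m y], [cls m (x \<odot>\<^bsub>X\<^esub> y)]) \<in> word_conv M X \<alpha>"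
    if "m \<in> carrier M" "x \<in> carrier X" "y \<in> carrier X" for m x y
  proof -
    have "([] @ [cls m x, cls m y] @ [], [] @ [cls m (x \<odot>\<^bsub>X\<^esub> y)] @ []) \<in> word_step M X \<alpha>"
      unfolding word_step_def using that by blast
    then show ?thesis
      unfolding word_conv_def using equiv_closure_superset by fastforce
  qed
  then show "R\<^sub>c \<subseteq> word_conv M X \<alpha>"
    unfolding R_sharp_def by (intro congruence_closure_least congruence_word_conv) auto
  have "word_step M X \<alpha> \<subseteq> R\<^sub>c"
    unfolding word_step_def by (blast intro: R_sharp_context R_sharp_generator)
  then show "word_conv M X \<alpha> \<subseteq> R\<^sub>c"
    unfolding word_conv_def
    by (intro equiv_closure_least congruence_onD(1)[OF congruence_R_sharp])
qed

section \<open>The quotient semigroup and its global action\<close>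

lemmas Q_simps =
  quotient_carrier[OF semigrp_free_semigroup congruence_R_sharp,
    folded beta_bar_semigroup_def]
  quotient_smult[OF semigrp_free_semigroup congruence_R_sharp,
    folded beta_bar_semigroup_def]

lemma semigrp_Q: "semigrp Q"
  unfolding beta_bar_semigroup_def
  by (rule semigrp_quotient[OF semigrp_free_semigroup congruence_R_sharp])

lemma map_shift_closed:
  "n \<in> carrier M \<Longrightarrow> w \<in> carrier words \<Longrightarrow> map (shift n) w \<in> carrier words"
  by (auto simp: free_semigroup_simps shift_closed)

lemma map_shift_hom:
  assumes "n \<in> carrier M"
  shows "(\<lambda>w. R\<^sub>c `` {map (shift n) w}) \<in> semigroup_hom words Q"
proof -
  have "R\<^sub>c `` {map (shift n) u @ map (shift n) v} =
      R\<^sub>c `` {map (shift n) u} \<odot>\<^bsub>Q\<^esub> R\<^sub>c `` {map (shift n) v}"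
    if "u \<in> carrier words" "v \<in> carrier words" for u v
    using Q_simps(2)[OF that[THEN map_shift_closed[OF assms]]] by (simp add: free_semigroup_simps)
  then show ?thesis
    using map_shift_closed[OF assms]
    by (auto simp: semigroup_hom_def Q_simps(1) free_semigroup_simps(2))
qed

lemma beta_bar_word:
  assumes "n \<in> carrier M" and "w \<in> carrier words"
  shows "\<beta> n (R\<^sub>c `` {w}) = Some (R\<^sub>c `` {map (shift n) w})"
proof -
  have "(\<lambda>w. R\<^sub>c `` {map (shift n) w}) ` (R\<^sub>c `` {w}) = {R\<^sub>c `` {map (shift n) w}}"
  proof (rule image_R_class[OF map_shift_hom[OF assms(1)] _ assms(2)])
    \<comment> \<open>The shift by \<open>n\<close> takes the defining relation at \<open>m\<close>
      to the defining relation at \<open>n \<otimes> m\<close>.\<close>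
    fix m x y assume "m \<in> carrier M" "x \<in> carrier X" "y \<in> carrier X"
    then show "R\<^sub>c `` {map (shift n) [cls m x, cls m y]} =
        R\<^sub>c `` {map (shift n) [cls m (x \<odot>\<^bsub>X\<^esub> y)]}"
      using assms(1) R_class_eq[OF R_sharp_generator[of "n \<otimes> m" x y]]
      by (simp add: shift_cls semigrp.smult_closed[OF semigrp_X])
  qed
  then have "(\<Union>v\<in>R\<^sub>c `` {w}. R\<^sub>c `` {map (shift n) v}) = R\<^sub>c `` {map (shift n) w}"
    by simp
  moreover have "R\<^sub>c `` {w} \<in> carrier Q"
    using assms(2) by (simp add: Q_simps(1))
  ultimately show ?thesis
    by (simp add: beta_bar_def)
qed

lemma global_action_beta_bar: "global_action M Q \<beta>"
proof (rule global_actionI[OF monoid_axioms semigrp_Q])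
  fix m assume m: "m \<in> carrier M"
  show "dom (\<beta> m) = carrier Q"
    by (auto simp: beta_bar_def split: if_splits)
  show "(\<lambda>W. the (\<beta> m W)) \<in> semigroup_hom Q Q"
    using semigroup_hom_quotientI[OF semigrp_free_semigroup congruence_R_sharp
        map_shift_hom[OF m], folded beta_bar_semigroup_def]
    by (simp add: beta_bar_word m)
next
  fix W assume "W \<in> carrier Q"
  then obtain w where w: "w \<in> carrier words" "W = R\<^sub>c `` {w}"
    by (auto simp: Q_simps(1))
  then have "map (shift \<one>) w = w"
    by (intro map_idI) (auto simp: free_semigroup_simps XM_eq_image shift_cls)
  with w show "\<beta> \<one> W = Some W"
    by (simp add: beta_bar_word)
next
  fix m n W assume mn: "m \<in> carrier M" "n \<in> carrier M" and "W \<in> carrier Q"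
  then obtain w where w: "w \<in> carrier words" "W = R\<^sub>c `` {w}"
    by (auto simp: Q_simps(1))
  then have "map (shift n) (map (shift m) w) = map (shift (n \<otimes> m)) w"
    using mn by (auto simp: free_semigroup_simps XM_eq_image shift_cls m_assoc)
  with mn w show "\<beta> n (the (\<beta> m W)) = \<beta> (n \<otimes> m) W"
    by (simp add: beta_bar_word map_shift_closed del: map_map)
qed

section \<open>The globalization criterion\<close>

lemma letter_in_words: "m \<in> carrier M \<Longrightarrow> x \<in> carrier X \<Longrightarrow> [cls m x] \<in> carrier words"
  by (simp add: free_semigroup_simps cls_in_XM)

lemma beta_bar_iota_bar:
  assumes "m \<in> carrier M" and "x \<in> carrier X"
  shows "\<beta> m (\<iota> x) = Some (R\<^sub>c `` {[cls m x]})"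
  unfolding iota_bar_def using assms
  by (simp add: beta_bar_word letter_in_words shift_cls)

lemma beta_bar_iota_bar_eq_iff:
  assumes "m \<in> carrier M" and "x \<in> carrier X" and "y \<in> carrier X"
  shows "\<beta> m (\<iota> x) = Some (\<iota> y) \<longleftrightarrow> ([cls m x], [cls \<one> y]) \<in> word_conv M X \<alpha>"
proof -
  have "\<beta> m (\<iota> x) = Some (\<iota> y) \<longleftrightarrow> R\<^sub>c `` {[cls m x]} = R\<^sub>c `` {[cls \<one> y]}"
    using assms by (simp add: beta_bar_iota_bar) (simp add: iota_bar_def)
  also have "\<dots> \<longleftrightarrow> ([cls m x], [cls \<one> y]) \<in> R\<^sub>c"
    using assms
    by (intro quotient_eq_iff[OF semigrp_free_semigroup congruence_R_sharp])
      (simp_all add: letter_in_words)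
  finally show ?thesis
    by (simp add: R_sharp_eq_word_conv)
qed

lemma iota_bar_morphism: "action_morphism M X \<alpha> Q \<beta> \<iota>"
  unfolding action_morphism_def
proof (intro conjI ballI)
  \<comment> \<open>Multiplicativity is the defining relation of R^# at the identity of the
    monoid.\<close>
  have "\<iota> (x \<odot>\<^bsub>X\<^esub> y) = \<iota> x \<odot>\<^bsub>Q\<^esub> \<iota> y" if "x \<in> carrier X" "y \<in> carrier X" for x y
    using that R_class_eq[OF R_sharp_generator[of \<one> x y]]
    by (simp add: iota_bar_def Q_simps(2) letter_in_words free_semigroup_simps(2))
  moreover have "\<iota> x \<in> carrier Q" if "x \<in> carrier X" for x
    using that by (simp add: iota_bar_def Q_simps(1) letter_in_words)
  ultimately show "\<iota> \<in> semigroup_hom X Q"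
    by (simp add: semigroup_hom_def)
  fix m x assume m: "m \<in> carrier M" and "x \<in> dom (\<alpha> m)"
  then obtain y where y: "\<alpha> m x = Some y" by blast
  with m have xy: "x \<in> carrier X" "y \<in> carrier X"
    by (blast dest: partial_action_closed)+
  then have "cls m x = cls \<one> y"
    using m y by (simp add: cls_eq_one_iff)
  with m xy y show "\<beta> m (\<iota> x) = Some (\<iota> (the (\<alpha> m x)))"
    by (simp add: beta_bar_iota_bar) (simp add: iota_bar_def)
qed

text \<open>The semigroup, action and morphism clauses always hold, leaving the last clause of a
  globalization: its premise becomes conversion of one-letter words, its conclusion equality in
  X_M.\<close>

lemma globalization_beta_bar_iff:
  "globalization M X \<alpha> Q \<beta> \<iota> \<longleftrightarrow>
    (\<forall>m\<in>carrier M. \<forall>x\<in>carrier X. \<forall>y\<in>carrier X.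
      ([cls m x], [cls \<one> y]) \<in> word_conv M X \<alpha> \<longrightarrow> cls m x = cls \<one> y)"
proof -
  have "(x \<in> dom (\<alpha> m) \<and> \<alpha> m x = Some y) \<longleftrightarrow> cls m x = cls \<one> y"
    if "m \<in> carrier M" "x \<in> carrier X" "y \<in> carrier X" for m x y
    using that by (auto simp: cls_eq_one_iff)
  then show ?thesis
    using semigrp_Q global_action_beta_bar iota_bar_morphism
    by (simp add: globalization_def beta_bar_iota_bar_eq_iff) blast
qed

section \<open>Uniqueness and existence of the mediating morphism\<close>

lemma morphism_from_Q_unique:
  assumes "action_morphism M Q \<beta> Z \<gamma> f" and "action_morphism M Q \<beta> Z \<gamma> g"
    and eq: "\<And>x. x \<in> carrier X \<Longrightarrow> f (\<iota> x) = g (\<iota> x)"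
    and "W \<in> carrier Q"
  shows "f W = g W"
proof -
  have hom: "f \<in> semigroup_hom Q Z" "g \<in> semigroup_hom Q Z"
    and val: "\<And>m x. m \<in> carrier M \<Longrightarrow> x \<in> carrier Q \<Longrightarrow> \<gamma> m (f x) = Some (f (the (\<beta> m x)))"
      "\<And>m x. m \<in> carrier M \<Longrightarrow> x \<in> carrier Q \<Longrightarrow> \<gamma> m (g x) = Some (g (the (\<beta> m x)))"
    using assms(1,2) global_action_beta_bar
    by (auto simp: action_morphism_def global_action_def)
  \<comment> \<open>The class of the word \<open>[cls m x]\<close> is the value of
    \<open>\<beta> m\<close> at \<open>\<iota> x\<close>, so equivariance determines a morphism
    there from its value at \<open>\<iota> x\<close>.\<close>
  have letter: "f (R\<^sub>c `` {[U]}) = g (R\<^sub>c `` {[U]})" if U: "U \<in> XM M X \<alpha>" for U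
  proof -
    obtain m x where mx: "m \<in> carrier M" "x \<in> carrier X" "U = cls m x"
      using U by (auto simp: XM_eq_image)
    then have "\<iota> x \<in> carrier Q"
      by (simp add: iota_bar_def Q_simps(1) letter_in_words)
    with val[OF mx(1), of "\<iota> x"] eq[OF mx(2)] mx show ?thesis
      by (simp add: beta_bar_iota_bar)
  qed
  have "f (R\<^sub>c `` {w}) = g (R\<^sub>c `` {w})" if "w \<noteq> []" "w \<in> lists (XM M X \<alpha>)" for w
    using that
  proof (induction w rule: list_nonempty_induct)
    case (single U)
    then show ?case by (simp add: letter)
  next
    case (cons U w)
    then have in_words: "[U] \<in> carrier words" "w \<in> carrier words"
      by (auto simp: free_semigroup_simps)
    then have "R\<^sub>c `` {U # w} = R\<^sub>c `` {[U]} \<odot>\<^bsub>Q\<^esub> R\<^sub>c `` {w}"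
      by (simp add: Q_simps(2) free_semigroup_simps(2))
    moreover have "R\<^sub>c `` {[U]} \<in> carrier Q" "R\<^sub>c `` {w} \<in> carrier Q"
      using in_words by (auto simp: Q_simps(1))
    ultimately show ?case
      using cons letter hom by (simp add: semigroup_homD(2))
  qed
  with assms(4) show ?thesis
    by (auto simp: Q_simps(1) free_semigroup_simps)
qed

text \<open>The map is built in three layers: on letters as equivariance forces it, on words by
  products in \<open>Z\<close>, and on R^#-classes by passing to the quotient.\<close>

lemma morphism_from_Q_exists:
  assumes "semigrp Z" and "global_action M Z \<gamma>" and "action_morphism M X \<alpha> Z \<gamma> \<kappa>"
  shows "\<exists>\<kappa>'. \<kappa>' \<in> extensional (carrier Q) \<and> action_morphism M Q \<beta> Z \<gamma> \<kappa>' \<and>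
    (\<forall>x\<in>carrier X. \<kappa>' (\<iota> x) = \<kappa> x)"
proof -
  note \<gamma> = global_actionD[OF assms(2)]
  have \<kappa>_hom: "\<kappa> \<in> semigroup_hom X Z"
    and \<kappa>_val: "\<And>m x y. m \<in> carrier M \<Longrightarrow> \<alpha> m x = Some y \<Longrightarrow> \<gamma> m (\<kappa> x) = Some (\<kappa> y)"
    using assms(3) by (auto simp: action_morphism_def dest!: bspec)
  define g where "g U = the_elem ((\<lambda>(m, x). the (\<gamma> m (\<kappa> x))) ` U)" for U
  have g: "g (cls m x) = the (\<gamma> m (\<kappa> x))" if "m \<in> carrier M" "x \<in> carrier X" for m x
  proof -
    \<comment> \<open>Independence of the representative: \<open>\<gamma> (n \<otimes> k)\<close> is
      \<open>\<gamma> n\<close> after \<open>\<gamma> k\<close>, and \<open>\<gamma> k\<close> takes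
      \<open>\<kappa> x\<close> to \<open>\<kappa> y\<close>.\<close>
    have "the (\<gamma> (n \<otimes> k) (\<kappa> x)) = the (\<gamma> n (\<kappa> y))"
      if "n \<in> carrier M" "k \<in> carrier M" "\<alpha> k x = Some y" for n k x y
      using \<gamma>(4)[of k n "\<kappa> x"] that \<kappa>_val[OF that(2,3)] semigroup_homD(1)[OF \<kappa>_hom]
        partial_action_closed[OF that(2,3)] by simp
    then show ?thesis
      unfolding g_def using that by (subst UN_cls) auto
  qed
  have g_closed: "g \<in> XM M X \<alpha> \<rightarrow> carrier Z"
    using semigroup_homD(1)[OF \<gamma>(2)] semigroup_homD(1)[OF \<kappa>_hom]
    by (auto simp: XM_eq_image g)
  have g_shift: "g (shift n U) = the (\<gamma> n (g U))" if "n \<in> carrier M" "U \<in> XM M X \<alpha>" for n U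
    using that \<gamma>(4) semigroup_homD(1)[OF \<kappa>_hom]
    by (auto simp: XM_eq_image shift_cls g)
  define h where "h w = semigroup_prod Z (map g w)" for w
  have h_hom: "h \<in> semigroup_hom words Z"
    unfolding h_def using assms(1) g_closed by (rule semigroup_prod_map_hom)
  have h_shift: "h (map (shift n) w) = the (\<gamma> n (h w))"
    if n: "n \<in> carrier M" and w: "w \<in> carrier words" for n w
  proof -
    have "map g w \<in> lists (carrier Z)" "map g w \<noteq> []"
      using w g_closed by (auto simp: Pi_iff free_semigroup_simps)
    \<comment> \<open>\<open>\<gamma> n\<close> is a homomorphism, so it can be applied factor by
      factor.\<close>
    then have "the (\<gamma> n (h w)) = semigroup_prod Z (map (\<lambda>z. the (\<gamma> n z)) (map g w))"
      unfolding h_def by (rule semigroup_hom_semigroup_prod[OF assms(1) \<gamma>(2)[OF n]])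
    moreover have "map (\<lambda>z. the (\<gamma> n z)) (map g w) = map g (map (shift n) w)"
      using w n by (auto simp: g_shift free_semigroup_simps)
    ultimately show ?thesis
      by (simp add: h_def del: map_map)
  qed
  \<comment> \<open>\<open>restrict\<close> makes the map extensional; \<open>the_elem\<close> is
    meaningful because \<open>h\<close> turns out to be constant on each class.\<close>
  define \<kappa>' where "\<kappa>' = restrict (\<lambda>W. the_elem (h ` W)) (carrier Q)"
  have \<kappa>': "\<kappa>' (R\<^sub>c `` {w}) = h w" if w: "w \<in> carrier words" for w
  proof -
    have "h ` (R\<^sub>c `` {w}) = {h w}"
    proof (rule image_R_class[OF h_hom _ w])
      \<comment> \<open>The defining relation is respected because both \<open>\<kappa>\<close> and
        \<open>\<gamma> m\<close> preserve products.\<close>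
      fix m x y assume "m \<in> carrier M" "x \<in> carrier X" "y \<in> carrier X"
      then show "h [cls m x, cls m y] = h [cls m (x \<odot>\<^bsub>X\<^esub> y)]"
        using semigroup_homD[OF \<kappa>_hom]
        by (simp add: h_def g semigrp.smult_closed[OF semigrp_X] semigroup_homD(2)[OF \<gamma>(2)])
    qed
    with w show ?thesis
      by (simp add: \<kappa>'_def Q_simps(1))
  qed
  have "\<kappa>' \<in> semigroup_hom Q Z"
    using semigroup_hom_quotientI[OF semigrp_free_semigroup congruence_R_sharp h_hom \<kappa>',
        folded beta_bar_semigroup_def] .
  moreover have "\<gamma> m (\<kappa>' W) = Some (\<kappa>' (the (\<beta> m W)))"
    if m: "m \<in> carrier M" and "W \<in> dom (\<beta> m)" for m W
  proof -
    have "W \<in> carrier Q"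
      using that global_action_beta_bar by (simp add: global_action_def)
    then obtain w where w: "w \<in> carrier words" "W = R\<^sub>c `` {w}"
      by (auto simp: Q_simps(1))
    with m \<gamma>(1)[OF m semigroup_homD(1)[OF h_hom w(1)]] show ?thesis
      by (simp add: \<kappa>' beta_bar_word map_shift_closed h_shift)
  qed
  moreover have "\<kappa>' (\<iota> x) = \<kappa> x" if "x \<in> carrier X" for x
    using that \<gamma>(3) semigroup_homD(1)[OF \<kappa>_hom]
    by (simp add: iota_bar_def \<kappa>' letter_in_words h_def g)
  ultimately show ?thesis
    by (intro exI[of _ \<kappa>']) (auto simp: action_morphism_def \<kappa>'_def)
qed

text \<open>A unique mediating morphism exists for every test globalization, so universality follows
  from being a globalization.\<close>

lemma universal_globalization_beta_bar_iff:
  "universal_globalization TYPE('z) M X \<alpha> Q \<beta> \<iota> \<longleftrightarrow> globalization M X \<alpha> Q \<beta> \<iota>"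
proof -
  have "\<exists>!\<kappa>'. \<kappa>' \<in> extensional (carrier Q) \<and> action_morphism M Q \<beta> Z \<gamma> \<kappa>' \<and>
      (\<forall>x\<in>carrier X. \<kappa>' (\<iota> x) = \<kappa> x)"
    if "globalization M X \<alpha> Z \<gamma> \<kappa>" for Z :: "'z semigroup_rec" and \<gamma> \<kappa>
  proof (rule ex_ex1I)
    show "\<exists>\<kappa>'. \<kappa>' \<in> extensional (carrier Q) \<and> action_morphism M Q \<beta> Z \<gamma> \<kappa>' \<and>
        (\<forall>x\<in>carrier X. \<kappa>' (\<iota> x) = \<kappa> x)"
      using that by (intro morphism_from_Q_exists) (auto simp: globalization_def)
    fix f g
    assume f: "f \<in> extensional (carrier Q) \<and> action_morphism M Q \<beta> Z \<gamma> f \<and>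
        (\<forall>x\<in>carrier X. f (\<iota> x) = \<kappa> x)"
      and g: "g \<in> extensional (carrier Q) \<and> action_morphism M Q \<beta> Z \<gamma> g \<and>
        (\<forall>x\<in>carrier X. g (\<iota> x) = \<kappa> x)"
    \<comment> \<open>Agreement on the carrier suffices, since extensional maps are both
      \<open>undefined\<close> outside it.\<close>
    have "f W = g W" if "W \<in> carrier Q" for W
      by (rule morphism_from_Q_unique[of Z \<gamma>, OF _ _ _ that]) (simp_all add: f g)
    with f g show "f = g"
      by (blast intro: extensionalityI)
  qed
  then show ?thesis
    by (simp add: universal_globalization_def)
qed

end

theorem proposition2p11:
  fixes M :: "('m, 'b) monoid_scheme"
    and X :: "'x semigroup_rec"
    and \<alpha> :: "'m \<Rightarrow> 'x \<rightharpoonup> 'x"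
  assumes "monoid M"
    and "semigrp X"
    and "strong_partial_action M X \<alpha>"
  shows "universal_globalization TYPE('z) M X \<alpha>
           (beta_bar_semigroup M X \<alpha>) (beta_bar M X \<alpha>) (iota_bar M X \<alpha>)
         \<longleftrightarrow>
         (\<forall>m\<in>carrier M. \<forall>x\<in>carrier X. \<forall>y\<in>carrier X.
            ([XM_class M X \<alpha> m x], [XM_class M X \<alpha> \<one>\<^bsub>M\<^esub> y]) \<in> word_conv M X \<alpha>
            \<longrightarrow> XM_class M X \<alpha> m x = XM_class M X \<alpha> \<one>\<^bsub>M\<^esub> y)"
proof -
  interpret semigroup_partial_action M X \<alpha>
    using assms by (simp add: semigroup_partial_action_def semigroup_partial_action_axioms_def)
  show ?thesis
    by (simp only: universal_globalization_beta_bar_iff globalization_beta_bar_iff)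
qed

end
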